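(* Let $\chi<\kappa$ be infinite regular cardinals, let $\vec C=\langle C_\alpha\mid\alpha<\kappa\rangle$ be a $C$-sequence over $\kappa$, and let $G$ be a cofinal subset of $\kappa$, such that: \begin{itemize} \item[($\aleph$)] for all $\alpha\in\kappa\setminus G$, $C_\alpha\cap G=\emptyset$; \item[($\beth$)] for all $\alpha\in G$ and $\bar\alpha\in\mathrm{acc}(C_\alpha)$ with $\mathrm{cf}(\bar\alpha)=\chi$, we have $\bar\alpha\in G$ and $C_{\bar\alpha}=C_\alpha\cap\bar\alpha$. \end{itemize} Then: \begin{enumerate} \item For all $\delta<\kappa$, the following holds: for every $x\in[\chi]^\chi$, every $\varepsilon\le\delta$, and every suitable coloring $c:\varepsilon\to\chi$, there exists a suitable coloring $c':\delta\to\chi$ extending $c$ such that $c'[\delta\setminus\varepsilon]\subseteq x$. \item If there is a club $D$ in $\kappa$ such that $D\cap\eta=C_\eta$ for all $\eta\in\mathrm{acc}(D)\cap G$ with $\mathrm{cf}(\eta)=\chi$, then $\mathrm{Chr}(G(\vec C))\le\chi$. \end{enumerate}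
   Context: For a set of ordinals $C$, $\mathrm{acc}(C)=\{\alpha\in C\mid\sup(C\cap\alpha)=\alpha>0\}$. A $C$-sequence over $\kappa$ is a sequence $\langle C_\alpha\mid\alpha<\kappa\rangle$ such that, for all limit $\alpha<\kappa$, $C_\alpha$ is a club subset of $\alpha$. For $\beta<\kappa$, $N_\beta:=\{\alpha\in C_\beta\cap G\mid\min(C_\alpha)>\sup(C_\beta\cap\alpha)\ge\min(C_\beta)\}$. The $C$-sequence graph is $G(\vec C):=(G,E)$ with $E:=\{\{\alpha,\beta\}\in[G]^2\mid\alpha\in N_\beta\}$. $\mathrm{Chr}(\mathcal G)$ is the chromatic number of a graph $\mathcal G$: the least cardinal $\nu$ such that there is a function $c$ from the vertices of $\mathcal G$ to $\nu$ with $c(x)\ne c(y)$ for all edges $\{x,y\}$. For an ordinal $\delta\le\kappa$, a function $c:\delta\to\chi$ is a suitable coloring if: $c(\alpha)\ne c(\beta)$ for all $\{\alpha,\beta\}\in E\cap[\delta]^2$; and $|c[N_\gamma]|<\chi$ for all $\gamma<\kappa$ (where $c[N_\gamma]=\{c(\alpha)\mid\alpha\in N_\gamma\cap\delta\}$).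
   Formalization: For non-limit α, C_α is additionally assumed to be a closed subset of α (possibly empty or bounded); with arbitrary sets C_α at non-limit α the claim is false, since G can then be a clique of size κ. Membership α∈N_β also requires C_α to be nonempty. *)

theory Defs
  imports Main
begin

unbundle cardinal_syntax

text \<open>
  The ordinal \<open>\<kappa>\<close> is a well-ordered type \<open>'k\<close>: its elements are the ordinals below \<open>\<kappa>\<close>. As with von
  Neumann ordinals, an ordinal is identified with the set of its predecessors, so \<open>\<delta> < \<kappa>\<close> appears
  as \<open>{..<\<delta>}\<close> where a set is expected, and \<open>\<kappa>\<close> itself is \<open>UNIV\<close>.
\<close>

definition zero_ord :: "'k::wellorder" where
  "zero_ord = (LEAST x. True)"

text \<open>Only meaningful for bounded sets; the supremum of the empty set is \<open>zero_ord\<close>.\<close>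

definition osup :: "'k::wellorder set \<Rightarrow> 'k" where
  "osup S = (LEAST u. \<forall>x\<in>S. x \<le> u)"

definition omin :: "'k::wellorder set \<Rightarrow> 'k" where
  "omin S = (LEAST x. x \<in> S)"

definition limit_ord :: "'k::wellorder \<Rightarrow> bool" where
  "limit_ord \<alpha> \<longleftrightarrow> zero_ord < \<alpha> \<and> (\<forall>\<beta><\<alpha>. \<exists>\<gamma>. \<beta> < \<gamma> \<and> \<gamma> < \<alpha>)"

definition acc :: "'k::wellorder set \<Rightarrow> 'k set" where
  "acc S = {\<alpha>\<in>S. osup (S \<inter> {..<\<alpha>}) = \<alpha> \<and> zero_ord < \<alpha>}"

definition unbounded_in :: "'k::wellorder set \<Rightarrow> 'k set \<Rightarrow> bool" where
  "unbounded_in S A \<longleftrightarrow> S \<subseteq> A \<and> (\<forall>\<xi>\<in>A. \<exists>\<gamma>\<in>S. \<xi> \<le> \<gamma>)"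

definition closed_in :: "'k::wellorder set \<Rightarrow> 'k set \<Rightarrow> bool" where
  "closed_in S A \<longleftrightarrow> S \<subseteq> A \<and>
     (\<forall>\<gamma>\<in>A. osup (S \<inter> {..<\<gamma>}) = \<gamma> \<and> zero_ord < \<gamma> \<longrightarrow> \<gamma> \<in> S)"

definition club_in :: "'k::wellorder set \<Rightarrow> 'k set \<Rightarrow> bool" where
  "club_in S A \<longleftrightarrow> closed_in S A \<and> unbounded_in S A"

text \<open>
  An ordinal, given as the set of its predecessors, that is an infinite regular cardinal.
\<close>

definition infinite_regular_cardinal :: "'k::wellorder set \<Rightarrow> bool" where
  "infinite_regular_cardinal A \<longleftrightarrow>
     Cinfinite (relation_of (\<le>) A) \<and> regularCard (relation_of (\<le>) A)"

text \<open>
  The cofinality is the least cardinality of a cofinal subset; being the least \<open>\<mu>\<close>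
  equinumerous to such a subset makes \<open>\<mu>\<close> an initial ordinal.
\<close>

definition cf :: "'k::wellorder \<Rightarrow> 'k" where
  "cf \<alpha> = (LEAST \<mu>. \<exists>A. unbounded_in A {..<\<alpha>} \<and> |A| =o |{..<\<mu>}| )"

text \<open>
  Non-limit indices: \<open>C \<alpha>\<close> is still required to be a closed subset of \<open>\<alpha>\<close>, but nothing else. This
  covers all usual normalisations (such as \<open>C 0 = {}\<close> and \<open>C (\<alpha> + 1) = {\<alpha>}\<close>), while
  sets \<open>C \<alpha>\<close> that are not subsets of \<open>\<alpha>\<close> are excluded.
\<close>

definition C_sequence :: "('k::wellorder \<Rightarrow> 'k set) \<Rightarrow> bool" where
  "C_sequence C \<longleftrightarrow>
     (\<forall>\<alpha>. closed_in (C \<alpha>) {..<\<alpha>} \<and> (limit_ord \<alpha> \<longrightarrow> club_in (C \<alpha>) {..<\<alpha>}))"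

text \<open>
  A comparison with \<open>min (C \<alpha>)\<close> presupposes that \<open>C \<alpha>\<close> is nonempty; \<open>C \<beta>\<close> is so because it
  contains \<open>\<alpha>\<close>.
\<close>

definition N_set :: "('k::wellorder \<Rightarrow> 'k set) \<Rightarrow> 'k set \<Rightarrow> 'k \<Rightarrow> 'k set" where
  "N_set C G \<beta> = {\<alpha> \<in> C \<beta> \<inter> G. C \<alpha> \<noteq> {} \<and>
     omin (C \<alpha>) > osup (C \<beta> \<inter> {..<\<alpha>}) \<and> osup (C \<beta> \<inter> {..<\<alpha>}) \<ge> omin (C \<beta>)}"

definition C_edges :: "('k::wellorder \<Rightarrow> 'k set) \<Rightarrow> 'k set \<Rightarrow> 'k set set" where
  "C_edges C G = {{\<alpha>, \<beta>} | \<alpha> \<beta>. \<alpha> \<in> G \<and> \<beta> \<in> G \<and> \<alpha> \<noteq> \<beta> \<and> \<alpha> \<in> N_set C G \<beta>}"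

definition C_graph :: "('k::wellorder \<Rightarrow> 'k set) \<Rightarrow> 'k set \<Rightarrow> 'k set \<times> 'k set set" where
  "C_graph C G = (G, C_edges C G)"

definition colorable :: "'v set \<times> 'v set set \<Rightarrow> 'c rel \<Rightarrow> bool" where
  "colorable = (\<lambda>(V, E) \<nu>. \<exists>c. c ` V \<subseteq> Field \<nu> \<and>
     (\<forall>x\<in>V. \<forall>y\<in>V. {x, y} \<in> E \<longrightarrow> c x \<noteq> c y))"

text \<open>
  The chromatic number is a cardinal in the sense of the library, i.e. a minimal well-order. It is
  unique up to \<open>=o\<close>, and it suffices to let cardinals range over relations on the vertex
  type, since a loopless graph \<open>(V, E)\<close> is \<open>|V|\<close>-colorable.
\<close>

definition is_Chr :: "'v set \<times> 'v set set \<Rightarrow> 'v rel \<Rightarrow> bool" where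
  "is_Chr \<G> \<nu> \<longleftrightarrow> Card_order \<nu> \<and> colorable \<G> \<nu> \<and>
     (\<forall>\<mu> :: 'v rel. Card_order \<mu> \<and> colorable \<G> \<mu> \<longrightarrow> \<nu> \<le>o \<mu>)"

definition Chr :: "'v set \<times> 'v set set \<Rightarrow> 'v rel" where
  "Chr \<G> = (SOME \<nu>. is_Chr \<G> \<nu>)"

lemma is_Chr_Chr:
  assumes "\<And>x. x \<in> V \<Longrightarrow> {x} \<notin> E"
  shows "is_Chr (V, E) (Chr (V, E))"
proof -
  let ?R = "{\<nu> :: 'a rel. Card_order \<nu> \<and> colorable (V, E) \<nu>}"
  have "colorable (V, E) |V|"
    unfolding colorable_def using assms by (auto intro!: exI[of _ id] simp: Field_card_of)
  then have "?R \<noteq> {}"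
    using card_of_Card_order by blast
  then have "\<exists>\<nu>\<in>?R. \<forall>\<mu>\<in>?R. \<nu> \<le>o \<mu>"
    by (intro exists_minim_Card_order) auto
  then have "\<exists>\<nu>. is_Chr (V, E) \<nu>"
    unfolding is_Chr_def by blast
  then show ?thesis
    unfolding Chr_def by (rule someI_ex)
qed

text \<open>The domain \<open>D\<close> is an ordinal \<open>\<delta> \<le> \<kappa>\<close>, i.e. \<open>{..<\<delta>}\<close> or \<open>UNIV\<close>; values of \<open>c\<close> outside \<open>D\<close> are ignored.\<close>

definition suitable_coloring ::
  "('k::wellorder \<Rightarrow> 'k set) \<Rightarrow> 'k set \<Rightarrow> 'k \<Rightarrow> 'k set \<Rightarrow> ('k \<Rightarrow> 'k) \<Rightarrow> bool" where
  "suitable_coloring C G \<chi> D c \<longleftrightarrow>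
     c ` D \<subseteq> {..<\<chi>} \<and>
     (\<forall>\<alpha>\<in>D. \<forall>\<beta>\<in>D. {\<alpha>, \<beta>} \<in> C_edges C G \<longrightarrow> c \<alpha> \<noteq> c \<beta>) \<and>
     (\<forall>\<gamma>. |c ` (N_set C G \<gamma> \<inter> D)| <o |{..<\<chi>}| )"

end

theory Submission
  imports Defs
begin

text \<open>
  Both parts rest on one construction: extend a suitable coloring step by step along a club \<open>D\<close>,
  filling each gap between consecutive points of \<open>D\<close> with an extension known to exist by
  induction. The proper coloring condition is then easy to keep, since a new point \<open>\<beta>\<close> has to
  avoid only the fewer than \<open>\<chi>\<close> colors used on \<open>N\<^bsub>\<beta>\<^esub>\<close>. The danger is at limits \<open>s\<close>, where
  some \<open>N\<^bsub>\<gamma>\<^esub>\<close> that is unbounded in \<open>s\<close> may collect \<open>\<chi>\<close> colors although it has fewer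
  below every \<open>t < s\<close>.

  If \<open>cf s \<noteq> \<chi>\<close>, this cannot happen, by regularity of \<open>\<chi>\<close> (\<open>small_if_initial_parts_small\<close>). If
  \<open>cf s = \<chi>\<close> and \<open>N\<^bsub>\<gamma>\<^esub>\<close> is unbounded in \<open>s\<close>, then \<open>s\<close> equals \<open>\<gamma>\<close> or is an accumulation point of
  \<open>C\<^bsub>\<gamma>\<^esub>\<close>, and the coherence hypothesis gives \<open>s \<in> G\<close> and \<open>C\<^bsub>s\<^esub> = C\<^bsub>\<gamma>\<^esub> \<inter> s\<close>
  (\<open>N_unbounded_below\<close>). So all dangerous \<open>\<gamma>\<close> agree below \<open>s\<close>, and the single set \<open>N\<^bsub>s\<^esub>\<close> has to be kept
  small. This is done by giving one color \<open>\<xi>\<close>, reserved in advance, to all of it above some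
  \<open>d < s\<close> (\<open>suitable_limit\<close>).

  One color suffices because an element \<open>\<alpha>\<close> of \<open>N\<^bsub>s\<^esub>\<close> has \<open>C\<^bsub>\<alpha>\<^esub>\<close> lying entirely above the preceding
  points of \<open>C\<^bsub>s\<^esub>\<close>: no point of \<open>N\<^bsub>\<alpha>\<^esub>\<close> belongs to \<open>N\<^bsub>s\<^esub>\<close>, nor lies below \<open>d\<close> when \<open>d \<in> C\<^bsub>s\<^esub>\<close> and
  \<open>d < \<alpha>\<close>, and all other points above \<open>d\<close> receive colors different from \<open>\<xi>\<close>. Moreover \<open>N\<^bsub>s\<^esub>\<close> is
  determined locally by \<open>C\<^bsub>s\<^esub>\<close>, so that along a club \<open>D\<close> with \<open>D \<inter> s = C\<^bsub>s\<^esub>\<close> at all \<open>s \<in> acc D \<inter> G\<close> of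
  cofinality \<open>\<chi>\<close> the same reserved color serves every dangerous limit at once
  (\<open>extension_along_club\<close>).

  For a limit \<open>\<delta>\<close>, the club \<open>D = C\<^bsub>\<delta>\<^esub>\<close> is of this kind: a point of \<open>acc C\<^bsub>\<delta>\<^esub> \<inter> G\<close> witnesses
  \<open>\<delta> \<in> G\<close>, since \<open>C\<^bsub>\<delta>\<^esub>\<close> is disjoint from \<open>G\<close> otherwise, and then coherence applies. The first part
  follows by induction on \<open>\<delta>\<close>. In the second part, the given \<open>D\<close> is of this kind by hypothesis, and the
  same construction runs through all of \<open>\<kappa>\<close>.
\<close>

section \<open>Ordinals as elements of a well-order\<close>

lemma zero_ord_le [simp]: "zero_ord \<le> (a :: 'k::wellorder)"
  unfolding zero_ord_def by (rule Least_le) simp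

lemma osup_upper:
  fixes \<eta> :: "'k::wellorder"
  assumes "\<eta> \<in> S" and "\<And>\<xi>. \<xi> \<in> S \<Longrightarrow> \<xi> \<le> b"
  shows "\<eta> \<le> osup S"
proof -
  have "\<forall>\<xi>\<in>S. \<xi> \<le> osup S"
    unfolding osup_def by (rule LeastI[of "\<lambda>u. \<forall>\<xi>\<in>S. \<xi> \<le> u" b]) (use assms in blast)
  then show ?thesis using assms(1) by blast
qed

text \<open>Accumulation points are used only in the form on the right, which mentions no supremum.\<close>

lemma osup_below_eq_iff:
  fixes \<gamma> :: "'k::wellorder"
  shows "osup (S \<inter> {..<\<gamma>}) = \<gamma> \<and> zero_ord < \<gamma> \<longleftrightarrow>
         zero_ord < \<gamma> \<and> (\<forall>\<xi><\<gamma>. \<exists>\<eta>\<in>S. \<xi> < \<eta> \<and> \<eta> < \<gamma>)"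
proof -
  let ?Q = "\<lambda>u. \<forall>\<eta>\<in>S \<inter> {..<\<gamma>}. \<eta> \<le> u"
  have Q: "?Q \<gamma>" by auto
  have "osup (S \<inter> {..<\<gamma>}) = \<gamma> \<longleftrightarrow> (\<forall>\<xi><\<gamma>. \<not> ?Q \<xi>)"
  proof
    assume "osup (S \<inter> {..<\<gamma>}) = \<gamma>"
    then show "\<forall>\<xi><\<gamma>. \<not> ?Q \<xi>"
      unfolding osup_def using not_less_Least[of _ ?Q] by metis
  next
    assume *: "\<forall>\<xi><\<gamma>. \<not> ?Q \<xi>"
    show "osup (S \<inter> {..<\<gamma>}) = \<gamma>"
      unfolding osup_def
      by (rule Least_equality) (use Q * not_le in blast)+
  qed
  also have "\<dots> \<longleftrightarrow> (\<forall>\<xi><\<gamma>. \<exists>\<eta>\<in>S. \<xi> < \<eta> \<and> \<eta> < \<gamma>)"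
    by (force simp: not_le)
  finally show ?thesis by blast
qed

lemma mem_acc_iff:
  fixes s :: "'k::wellorder"
  shows "s \<in> acc S \<longleftrightarrow> s \<in> S \<and> zero_ord < s \<and> (\<forall>\<xi><s. \<exists>\<eta>\<in>S. \<xi> < \<eta> \<and> \<eta> < s)"
  unfolding acc_def using osup_below_eq_iff[of S s] by blast

lemma closed_inD:
  fixes \<gamma> :: "'k::wellorder"
  assumes "closed_in S A" "\<gamma> \<in> A" "zero_ord < \<gamma>" "\<And>\<xi>. \<xi> < \<gamma> \<Longrightarrow> \<exists>\<eta>\<in>S. \<xi> < \<eta> \<and> \<eta> < \<gamma>"
  shows "\<gamma> \<in> S"
  using assms osup_below_eq_iff[of S \<gamma>] unfolding closed_in_def by blast

lemma limit_ordD: "limit_ord s \<Longrightarrow> \<xi> < s \<Longrightarrow> \<exists>\<eta>. \<xi> < \<eta> \<and> \<eta> < s"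
  unfolding limit_ord_def by blast

lemma cf_witness:
  fixes s :: "'k::wellorder"
  obtains A where "unbounded_in A {..<s}" "|A| =o |{..<cf s}|"
proof -
  have "\<exists>A. unbounded_in A {..<s} \<and> |A| =o |{..<s}|"
    by (rule exI[of _ "{..<s}"]) (auto simp: unbounded_in_def card_of_refl)
  then have "\<exists>A. unbounded_in A {..<s} \<and> |A| =o |{..<cf s}|"
    unfolding cf_def
    by (rule LeastI[of "\<lambda>\<mu>. \<exists>A. unbounded_in A {..<s} \<and> |A| =o |{..<\<mu>}|"])
  then show ?thesis using that by blast
qed

lemma cf_le:
  fixes s :: "'k::wellorder"
  assumes "unbounded_in A {..<s}" "|A| =o |{..<\<mu>}|"
  shows "cf s \<le> \<mu>"
  unfolding cf_def by (rule Least_le) (use assms in blast)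


section \<open>Small sets of colors\<close>

lemma regular_card_of:
  fixes \<chi> :: "'k::wellorder"
  assumes "infinite_regular_cardinal {..<\<chi>}"
  shows "Cinfinite |{..<\<chi>}|" "regularCard |{..<\<chi>}|"
    and "\<mu> < \<chi> \<Longrightarrow> |{..<\<mu>}| <o |{..<\<chi>}|"
proof -
  let ?r = "relation_of (\<le>) {..<\<chi>}"
  have F: "Field ?r = {..<\<chi>}"
    unfolding relation_of_def Field_def by auto
  have r: "Cinfinite ?r" "regularCard ?r"
    using assms unfolding infinite_regular_cardinal_def by auto
  have iso: "?r =o |{..<\<chi>}|"
    using card_of_Field_ordIso[of ?r] r F ordIso_symmetric by fastforce
  show "Cinfinite |{..<\<chi>}|" using Cinfinite_cong[OF iso r(1)] .
  show "regularCard |{..<\<chi>}|" using regularCard_ordIso[OF iso r] .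
  assume \<mu>: "\<mu> < \<chi>"
  have "underS ?r \<mu> = {..<\<mu>}"
    using \<mu> unfolding underS_def relation_of_def by auto
  then have "|{..<\<mu>}| <o ?r"
    using card_of_underS[of ?r \<mu>] r F \<mu> by simp
  then show "|{..<\<mu>}| <o |{..<\<chi>}|" using iso ordLess_ordIso_trans by blast
qed


section \<open>Skipping points of a set\<close>

text \<open>
  A superset of \<open>N\<^bsub>\<beta>\<^esub>\<close> for \<open>D = C\<^bsub>\<beta>\<^esub>\<close>, with the comparison of \<open>min C\<^bsub>\<alpha>\<^esub>\<close> and \<open>sup (D \<inter> \<alpha>)\<close> written
  without suprema and minima. It is defined for every set \<open>D\<close>, so as to apply to a club of \<open>\<kappa>\<close>,
  which is not the value of the sequence at any index. The name refers to \<open>C\<^bsub>\<alpha>\<^esub>\<close> skipping all of \<open>D\<close>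
  below \<open>\<alpha>\<close>.
\<close>

definition skipping :: "('k::wellorder \<Rightarrow> 'k set) \<Rightarrow> 'k set \<Rightarrow> 'k set \<Rightarrow> 'k set" where
  "skipping C G D = {\<alpha> \<in> D \<inter> G. \<forall>\<eta>\<in>D. \<eta> < \<alpha> \<longrightarrow> (\<forall>\<gamma>\<in>C \<alpha>. \<eta> < \<gamma>)}"

lemma skipping_local:
  assumes "D \<inter> {..<s} = D' \<inter> {..<s}"
  shows "skipping C G D \<inter> {..<s} = skipping C G D' \<inter> {..<s}"
proof -
  have "\<eta> \<in> D \<longleftrightarrow> \<eta> \<in> D'" if "\<eta> < s" for \<eta> using assms that by blast
  then show ?thesis unfolding skipping_def by (auto intro: less_trans)
qed

lemma N_set_subset_skipping: "N_set C G \<beta> \<subseteq> skipping C G (C \<beta>)"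
proof
  fix \<alpha> assume \<alpha>: "\<alpha> \<in> N_set C G \<beta>"
  have "\<eta> < \<gamma>" if "\<eta> \<in> C \<beta>" "\<eta> < \<alpha>" "\<gamma> \<in> C \<alpha>" for \<eta> \<gamma>
  proof -
    have "\<eta> \<le> osup (C \<beta> \<inter> {..<\<alpha>})" by (rule osup_upper[where b = \<alpha>]) (use that in auto)
    also have "\<dots> < omin (C \<alpha>)" using \<alpha> unfolding N_set_def by blast
    also have "\<dots> \<le> \<gamma>" unfolding omin_def using that(3) by (rule Least_le)
    finally show ?thesis .
  qed
  then show "\<alpha> \<in> skipping C G (C \<beta>)" using \<alpha> unfolding skipping_def N_set_def by blast
qed


section \<open>Suitable colorings\<close>

locale coherent_C_sequence =
  fixes \<chi> :: "'k::wellorder" and C :: "'k \<Rightarrow> 'k set" and G :: "'k set"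
  assumes regular: "infinite_regular_cardinal {..<\<chi>}"
    and C_seq: "C_sequence C"
    and avoids: "\<alpha> \<notin> G \<Longrightarrow> C \<alpha> \<inter> G = {}"
    and coherent: "\<alpha> \<in> G \<Longrightarrow> \<alpha>' \<in> acc (C \<alpha>) \<Longrightarrow> cf \<alpha>' = \<chi> \<Longrightarrow>
                     \<alpha>' \<in> G \<and> C \<alpha>' = C \<alpha> \<inter> {..<\<alpha>'}"
begin

abbreviation "N \<equiv> N_set C G"
abbreviation "skip \<equiv> skipping C G"
abbreviation "suitable \<equiv> suitable_coloring C G \<chi>"
abbreviation small :: "'k set \<Rightarrow> bool" where "small X \<equiv> |X| <o |{..<\<chi>}|"

lemma small_mono: "small X \<Longrightarrow> Y \<subseteq> X \<Longrightarrow> small Y"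
  using card_of_mono1 ordLeq_ordLess_trans by blast

lemma infinite_colors: "infinite {..<\<chi>}"
  using regular_card_of(1)[OF regular] unfolding cinfinite_def Field_card_of by simp

lemma small_finite: "finite X \<Longrightarrow> small X"
  using finite_ordLess_infinite[of "|X|" "|{..<\<chi>}|"] infinite_colors
  by (simp add: Field_card_of card_of_well_order_on)

lemma small_insert: "small X \<Longrightarrow> small (insert a X)"
  using card_of_Un_ordLess_infinite[OF infinite_colors, of "{a}" X]
    small_finite[of "{a}"] by simp

lemma small_UN: "small I \<Longrightarrow> (\<And>i. i \<in> I \<Longrightarrow> small (F i)) \<Longrightarrow> small (\<Union>i\<in>I. F i)"
  by (rule regularCard_UNION_bound[OF regular_card_of(1,2)[OF regular]])

lemma not_small_iff:
  assumes "X \<subseteq> {..<\<chi>}"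
  shows "\<not> small X \<longleftrightarrow> |X| =o |{..<\<chi>}|"
proof -
  have "\<not> small X \<longleftrightarrow> |{..<\<chi>}| \<le>o |X|"
    by (rule not_ordLess_iff_ordLeq) (rule card_of_Well_order)+
  moreover have "|X| \<le>o |{..<\<chi>}|" using assms by (rule card_of_mono1)
  ultimately show ?thesis unfolding ordIso_iff_ordLeq by blast
qed

lemma C_below: "C \<beta> \<subseteq> {..<\<beta>}"
  using C_seq unfolding C_sequence_def closed_in_def by blast

lemma C_closed: "closed_in (C \<beta>) {..<\<beta>}"
  using C_seq unfolding C_sequence_def by blast

lemma N_subset_C: "N \<beta> \<subseteq> C \<beta> \<inter> G"
  unfolding N_set_def by blast

lemma edge_iff:
  "{\<alpha>, \<beta>} \<in> C_edges C G \<longleftrightarrow> \<alpha> \<in> G \<and> \<beta> \<in> G \<and> \<alpha> \<noteq> \<beta> \<and> (\<alpha> \<in> N \<beta> \<or> \<beta> \<in> N \<alpha>)"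
  unfolding C_edges_def by (auto simp: doubleton_eq_iff)

lemma suitable_subset:
  assumes "suitable B c" "B' \<subseteq> B"
  shows "suitable B' c"
proof -
  have "small (c ` (N \<gamma> \<inter> B'))" for \<gamma>
  proof (rule small_mono)
    show "small (c ` (N \<gamma> \<inter> B))" using assms(1) unfolding suitable_coloring_def by blast
  qed (use assms(2) in blast)
  then show ?thesis using assms unfolding suitable_coloring_def by blast
qed

lemma suitable_cong:
  assumes "\<And>\<alpha>. \<alpha> \<in> B \<Longrightarrow> c \<alpha> = c' \<alpha>"
  shows "suitable B c \<longleftrightarrow> suitable B c'"
proof -
  have "c ` (X \<inter> B) = c' ` (X \<inter> B)" for X using assms by (intro image_cong) auto
  moreover have "c ` B = c' ` B" using assms by (rule image_cong[OF refl])
  ultimately show ?thesis unfolding suitable_coloring_def using assms by simp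
qed

lemma suitable_add_point:
  assumes c: "suitable {..<\<beta>} c" and v: "v < \<chi>" "v \<notin> c ` N \<beta>"
  shows "suitable {..\<beta>} (c(\<beta> := v))"
proof -
  let ?c = "c(\<beta> := v)"
  have bel: "\<alpha> \<in> N \<beta>' \<Longrightarrow> \<alpha> < \<beta>'" for \<alpha> \<beta>' using N_subset_C C_below by blast
  have "?c ` {..\<beta>} \<subseteq> {..<\<chi>}"
    using c v(1) unfolding suitable_coloring_def by (auto simp: image_subset_iff)
  moreover have "?c \<alpha> \<noteq> ?c \<alpha>'"
    if "\<alpha> \<le> \<beta>" "\<alpha>' \<le> \<beta>" "{\<alpha>, \<alpha>'} \<in> C_edges C G" for \<alpha> \<alpha>'
  proof -
    have N: "\<alpha> \<in> N \<alpha>' \<or> \<alpha>' \<in> N \<alpha>" "\<alpha> \<noteq> \<alpha>'" using that(3) edge_iff by blast+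
    have "\<alpha> < \<beta> \<or> \<alpha> = \<beta>" "\<alpha>' < \<beta> \<or> \<alpha>' = \<beta>" using that(1,2) by auto
    then consider "\<alpha> = \<beta>" "\<alpha>' < \<beta>" | "\<alpha>' = \<beta>" "\<alpha> < \<beta>" | "\<alpha> < \<beta>" "\<alpha>' < \<beta>"
      using N(2) by blast
    then show ?thesis
    proof cases
      case 1
      then have "\<alpha>' \<in> N \<beta>" using N(1) bel[of \<alpha> \<alpha>'] by auto
      then show ?thesis using 1 v(2) by auto
    next
      case 2
      then have "\<alpha> \<in> N \<beta>" using N(1) bel[of \<alpha>' \<alpha>] by auto
      then show ?thesis using 2 v(2) by auto
    next
      case 3
      then show ?thesis using c that(3) unfolding suitable_coloring_def by auto
    qed
  qed
  moreover have "small (?c ` (N \<gamma> \<inter> {..\<beta>}))" for \<gamma>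
  proof (rule small_mono)
    show "small (insert v (c ` (N \<gamma> \<inter> {..<\<beta>})))"
      using c small_insert unfolding suitable_coloring_def by blast
    show "?c ` (N \<gamma> \<inter> {..\<beta>}) \<subseteq> insert v (c ` (N \<gamma> \<inter> {..<\<beta>}))"
      by (auto simp: le_less)
  qed
  ultimately show ?thesis unfolding suitable_coloring_def by auto
qed


section \<open>Suitability at limits\<close>

text \<open>
  For \<open>cf s < \<chi>\<close> the image is a union of fewer than \<open>\<chi>\<close> small sets, hence small by regularity. For
  \<open>cf s > \<chi>\<close>, if \<open>\<chi>\<close> colors occurred, choosing one point for each would give a set of size \<open>\<chi>\<close>, which
  is bounded in \<open>s\<close>, so that all colors would occur already in an initial part.
\<close>

lemma small_if_initial_parts_small:
  assumes s: "limit_ord s" "cf s \<noteq> \<chi>"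
    and A: "A \<subseteq> {..<s}" "u ` A \<subseteq> {..<\<chi>}"
    and parts: "\<And>t. t < s \<Longrightarrow> small (u ` (A \<inter> {..<t}))"
  shows "small (u ` A)"
proof (cases "cf s < \<chi>")
  case True
  obtain B where B: "unbounded_in B {..<s}" "|B| =o |{..<cf s}|" by (rule cf_witness)
  have "small B"
    using B(2) regular_card_of(3)[OF regular True] ordIso_ordLess_trans by blast
  moreover have "small (u ` (A \<inter> {..b}))" if "b \<in> B" for b
  proof -
    have "b < s" using B(1) that unfolding unbounded_in_def by blast
    then obtain t where "b < t" "t < s" using limit_ordD[OF s(1)] by blast
    then show ?thesis by (intro small_mono[OF parts[of t]]) auto
  qed
  ultimately have "small (\<Union>b\<in>B. u ` (A \<inter> {..b}))" by (rule small_UN)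
  moreover have "u ` A \<subseteq> (\<Union>b\<in>B. u ` (A \<inter> {..b}))"
    using A(1) B(1) unfolding unbounded_in_def by fastforce
  ultimately show ?thesis by (rule small_mono)
next
  case False
  show ?thesis
  proof (rule ccontr)
    assume "\<not> small (u ` A)"
    then have full: "|u ` A| =o |{..<\<chi>}|" using not_small_iff A(2) by blast
    obtain P where P: "P \<subseteq> A" "inj_on u P" "u ` P = u ` A"
      using subset_image_inj[of "u ` A" u A] by auto
    have "|P| =o |{..<\<chi>}|"
      using card_of_ordIso P full by (metis bij_betw_def ordIso_transitive)
    then have "\<not> unbounded_in P {..<s}"
      using cf_le False s(2) by (metis le_less)
    then obtain t where "t < s" "\<forall>p\<in>P. p < t"
      using P(1) A(1) unfolding unbounded_in_def by (auto simp: not_le)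
    then have "u ` A \<subseteq> u ` (A \<inter> {..<t})"
      using P(1) unfolding P(3)[symmetric] by blast
    with parts[OF \<open>t < s\<close>] \<open>\<not> small (u ` A)\<close> show False
      using small_mono by blast
  qed
qed

text \<open>
  Here coherence enters: whichever \<open>\<gamma>\<close> has \<open>N\<^bsub>\<gamma>\<^esub>\<close> unbounded in \<open>s\<close>, the part below \<open>s\<close> is contained in a
  set that depends only on \<open>s\<close>.
\<close>

lemma N_unbounded_below:
  assumes s: "limit_ord s" "cf s = \<chi>"
    and unb: "\<And>\<xi>. \<xi> < s \<Longrightarrow> \<exists>\<alpha>\<in>N \<gamma>. \<xi> < \<alpha> \<and> \<alpha> < s"
  shows "s \<in> G" "N \<gamma> \<inter> {..<s} \<subseteq> skip (C s)"
proof -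
  have pos: "zero_ord < s" using s(1) unfolding limit_ord_def by blast
  have unbC: "\<exists>\<alpha>\<in>C \<gamma>. \<xi> < \<alpha> \<and> \<alpha> < s" if "\<xi> < s" for \<xi>
    using unb[OF that] N_subset_C by blast
  have "\<gamma> \<in> G" using unb[OF pos] N_subset_C avoids by blast
  have "s \<le> \<gamma>" using unbC[of \<gamma>] C_below by (meson lessThan_iff not_le order.asym subsetD)
  then have sG: "s \<in> G \<and> C s = C \<gamma> \<inter> {..<s}"
  proof (cases "s = \<gamma>")
    case True
    then show ?thesis using \<open>\<gamma> \<in> G\<close> C_below by blast
  next
    case False
    then have "s < \<gamma>" using \<open>s \<le> \<gamma>\<close> by simp
    then have "s \<in> C \<gamma>" by (intro closed_inD[OF C_closed]) (use pos unbC in auto)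
    then have "s \<in> acc (C \<gamma>)" using pos unbC by (simp add: mem_acc_iff)
    then show ?thesis using coherent \<open>\<gamma> \<in> G\<close> s(2) by blast
  qed
  then show "s \<in> G" by blast
  have "skip (C \<gamma>) \<inter> {..<s} = skip (C s) \<inter> {..<s}"
    by (rule skipping_local) (use sG in blast)
  then show "N \<gamma> \<inter> {..<s} \<subseteq> skip (C s)"
    using N_set_subset_skipping by blast
qed

text \<open>
  By the two preceding lemmas, only the set \<open>skip (C s)\<close> can spoil suitability at a limit, and it cannot do
  so if it is eventually monochromatic.
\<close>

lemma suitable_limit:
  assumes lim: "limit_ord s"
    and parts: "\<And>t. t < s \<Longrightarrow> suitable {..<t} u"
    and const: "cf s = \<chi> \<Longrightarrow> s \<in> G \<Longrightarrow>
      \<exists>d<s. \<exists>\<xi>. \<forall>\<alpha>\<in>skip (C s). d < \<alpha> \<and> \<alpha> < s \<longrightarrow> u \<alpha> = \<xi>"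
  shows "suitable {..<s} u"
proof -
  have part: "small (u ` (N \<gamma> \<inter> {..<t}))" if "t < s" for \<gamma> t
    using parts[OF that] unfolding suitable_coloring_def by blast
  have range: "u ` {..<s} \<subseteq> {..<\<chi>}"
  proof
    fix y assume "y \<in> u ` {..<s}"
    then obtain \<alpha> where "\<alpha> < s" "y = u \<alpha>" by blast
    moreover obtain t where "\<alpha> < t" "t < s" using limit_ordD[OF lim \<open>\<alpha> < s\<close>] by blast
    ultimately show "y \<in> {..<\<chi>}"
      using parts[of t] unfolding suitable_coloring_def by blast
  qed
  have "u \<alpha> \<noteq> u \<beta>" if "\<alpha> < s" "\<beta> < s" "{\<alpha>, \<beta>} \<in> C_edges C G" for \<alpha> \<beta>
  proof -
    have "max \<alpha> \<beta> < s" using that by simp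
    then obtain t where "max \<alpha> \<beta> < t" "t < s" using limit_ordD[OF lim] by blast
    then show ?thesis
      using parts[of t] that(3) unfolding suitable_coloring_def by auto
  qed
  moreover have "small (u ` (N \<gamma> \<inter> {..<s}))" for \<gamma>
  proof (cases "cf s = \<chi>")
    case False
    show ?thesis
    proof (rule small_if_initial_parts_small[OF lim False])
      fix t assume "t < s"
      then show "small (u ` (N \<gamma> \<inter> {..<s} \<inter> {..<t}))"
        by (intro small_mono[OF part]) auto
    qed (use range in auto)
  next
    case True
    show ?thesis
    proof (cases "\<forall>\<xi><s. \<exists>\<alpha>\<in>N \<gamma>. \<xi> < \<alpha> \<and> \<alpha> < s")
      case False
      then obtain \<xi> where \<xi>: "\<xi> < s" "\<forall>\<alpha>\<in>N \<gamma>. \<alpha> < s \<longrightarrow> \<alpha> \<le> \<xi>" by (meson not_less)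
      obtain t where "\<xi> < t" "t < s" using limit_ordD[OF lim \<xi>(1)] by blast
      then show ?thesis using \<xi>(2) by (intro small_mono[OF part[of t]]) auto
    next
      case unb: True
      have sG: "s \<in> G" and sub: "N \<gamma> \<inter> {..<s} \<subseteq> skip (C s)"
        using N_unbounded_below[OF lim True, of \<gamma>] unb by blast+
      obtain d \<xi> where d: "d < s" "\<forall>\<alpha>\<in>skip (C s). d < \<alpha> \<and> \<alpha> < s \<longrightarrow> u \<alpha> = \<xi>"
        using const[OF True sG] by blast
      obtain t where t: "d < t" "t < s" using limit_ordD[OF lim d(1)] by blast
      show ?thesis
      proof (rule small_mono)
        show "small (insert \<xi> (u ` (N \<gamma> \<inter> {..<t})))" using part[OF t(2)] small_insert by blast
        show "u ` (N \<gamma> \<inter> {..<s}) \<subseteq> insert \<xi> (u ` (N \<gamma> \<inter> {..<t}))"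
        proof
          fix y assume "y \<in> u ` (N \<gamma> \<inter> {..<s})"
          then obtain \<alpha> where \<alpha>: "\<alpha> \<in> N \<gamma>" "\<alpha> < s" "y = u \<alpha>" by blast
          show "y \<in> insert \<xi> (u ` (N \<gamma> \<inter> {..<t}))"
          proof (cases "d < \<alpha>")
            case True
            then show ?thesis using d(2) \<alpha> sub by blast
          next
            case False
            then have "\<alpha> < t" using t(1) by simp
            then show ?thesis using \<alpha> by blast
          qed
        qed
      qed
    qed
  qed
  ultimately show ?thesis using range unfolding suitable_coloring_def by blast
qed


section \<open>Extension along a club\<close>

definition extendable :: "'k \<Rightarrow> bool" where
  "extendable \<delta> \<longleftrightarrow> (\<forall>x. x \<subseteq> {..<\<chi>} \<and> |x| =o |{..<\<chi>}| \<longrightarrow>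
     (\<forall>\<epsilon>\<le>\<delta>. \<forall>c. suitable {..<\<epsilon>} c \<longrightarrow>
       (\<exists>c'. suitable {..<\<delta>} c' \<and> (\<forall>\<alpha><\<epsilon>. c' \<alpha> = c \<alpha>) \<and> c' ` ({..<\<delta>} - {..<\<epsilon>}) \<subseteq> x)))"

lemma extendableE:
  assumes "extendable \<delta>" "x \<subseteq> {..<\<chi>}" "|x| =o |{..<\<chi>}|" "\<epsilon> \<le> \<delta>" "suitable {..<\<epsilon>} c"
  obtains c' where "suitable {..<\<delta>} c'" "\<And>\<alpha>. \<alpha> < \<epsilon> \<Longrightarrow> c' \<alpha> = c \<alpha>"
    "\<And>\<alpha>. \<epsilon> \<le> \<alpha> \<Longrightarrow> \<alpha> < \<delta> \<Longrightarrow> c' \<alpha> \<in> x"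
proof -
  obtain c' where "suitable {..<\<delta>} c'" "\<forall>\<alpha><\<epsilon>. c' \<alpha> = c \<alpha>" "c' ` ({..<\<delta>} - {..<\<epsilon>}) \<subseteq> x"
    using assms(1)[unfolded extendable_def, rule_format, OF conjI[OF assms(2,3)] assms(4,5)] by blast
  then show ?thesis by (intro that[of c']) (auto simp: image_subset_iff)
qed

lemma full_minus_small:
  assumes "x \<subseteq> {..<\<chi>}" "|x| =o |{..<\<chi>}|" "small Y"
  obtains v where "v \<in> x" "v \<notin> Y" "v < \<chi>"
proof -
  have "\<not> small x" using assms(1,2) not_small_iff by blast
  then have "\<not> x \<subseteq> Y" using assms(3) small_mono by blast
  then show ?thesis using that assms(1) by blast
qed

text \<open>
  The central construction. In the applications, the initial segment \<open>A\<close> is a limit ordinal or the whole of \<open>\<kappa>\<close>.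
  The conclusion says nothing about suitability on \<open>A\<close> itself. When \<open>A\<close> is a limit ordinal, it
  follows from \<open>suitable_limit\<close>, for which the eventually constant value \<open>\<xi>\<close> on \<open>skip D\<close> is recorded; when
  \<open>A\<close> is \<open>\<kappa>\<close>, only proper coloring is wanted, which concerns two points at a time.
\<close>

lemma extension_along_club:
  assumes x: "x \<subseteq> {..<\<chi>}" "|x| =o |{..<\<chi>}|"
    and A: "\<And>\<alpha> \<beta>. \<beta> \<in> A \<Longrightarrow> \<alpha> \<le> \<beta> \<Longrightarrow> \<alpha> \<in> A"
    and D: "club_in D A"
    and guess: "\<And>\<eta>. \<eta> \<in> acc D \<inter> G \<Longrightarrow> cf \<eta> = \<chi> \<Longrightarrow> D \<inter> {..<\<eta>} = C \<eta>"
    and ext: "\<And>\<beta>. \<beta> \<in> A \<Longrightarrow> extendable \<beta>"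
    and \<epsilon>: "\<epsilon> \<in> A" and c: "suitable {..<\<epsilon>} c"
  obtains c' d \<xi> where "\<And>\<eta>. \<eta> \<in> A \<Longrightarrow> suitable {..\<eta>} c'" "\<And>\<alpha>. \<alpha> < \<epsilon> \<Longrightarrow> c' \<alpha> = c \<alpha>"
    "\<And>\<alpha>. \<epsilon> \<le> \<alpha> \<Longrightarrow> \<alpha> \<in> A \<Longrightarrow> c' \<alpha> \<in> x"
    "d \<in> A" "\<And>\<alpha>. \<alpha> \<in> skip D \<Longrightarrow> d < \<alpha> \<Longrightarrow> c' \<alpha> = \<xi>"
proof -
  have DA: "D \<subseteq> A" and Dcl: "closed_in D A" and Dunb: "\<And>\<xi>. \<xi> \<in> A \<Longrightarrow> \<exists>\<eta>\<in>D. \<xi> \<le> \<eta>"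
    using D unfolding club_in_def closed_in_def unbounded_in_def by blast+
  \<comment> \<open>The construction along \<open>D\<close> starts at a point of \<open>D\<close>: this keeps \<open>N \<alpha>\<close>, for \<open>\<alpha> \<in> skip D\<close> above \<open>d\<close>, away from
    the part where the given coloring may already use the reserved color \<open>\<xi>\<close>.\<close>
  obtain d where d: "d \<in> D" "\<epsilon> \<le> d" using Dunb[OF \<epsilon>] by blast
  have dA: "d \<in> A" using d DA by blast
  obtain c0 where c0: "suitable {..<d} c0" "\<And>\<alpha>. \<alpha> < \<epsilon> \<Longrightarrow> c0 \<alpha> = c \<alpha>"
      "\<And>\<alpha>. \<epsilon> \<le> \<alpha> \<Longrightarrow> \<alpha> < d \<Longrightarrow> c0 \<alpha> \<in> x"
    using extendableE[OF ext[OF dA] x d(2) c] by blast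
  have inf_x: "infinite x"
    using infinite_colors x(2) card_of_ordIso_finite by blast
  then obtain \<xi> where \<xi>: "\<xi> \<in> x" by (metis finite.emptyI ex_in_conv)
  define x' where "x' = x - {\<xi>}"
  have x'_sub: "x' \<subseteq> {..<\<chi>}" and "x \<subseteq> insert \<xi> x'" using x(1) unfolding x'_def by auto
  then have "\<not> small x'" using small_insert[of x' \<xi>] small_mono not_small_iff x by blast
  with x'_sub have x': "x' \<subseteq> {..<\<chi>}" "|x'| =o |{..<\<chi>}|" using not_small_iff by blast+
  define M where "M = {\<alpha> \<in> skip D. d < \<alpha>}"
  define good where "good \<beta> r \<longleftrightarrow> suitable {..\<beta>} r \<and> (\<forall>\<alpha><d. r \<alpha> = c0 \<alpha>) \<and>
      (\<forall>\<alpha>. d \<le> \<alpha> \<and> \<alpha> \<le> \<beta> \<longrightarrow> (if \<alpha> \<in> M then r \<alpha> = \<xi> else r \<alpha> \<in> x'))" for \<beta> r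
  \<comment> \<open>Recursion along \<open>D'\<close>: the stage \<open>\<beta>\<close> is a whole coloring of \<open>{..\<beta>}\<close> that agrees with all earlier stages.\<close>
  define D' where "D' = {\<beta> \<in> D. d \<le> \<beta>}"
  have "\<exists>f. \<forall>\<beta>. \<beta> \<in> D' \<longrightarrow> good \<beta> (f \<beta>) \<and> (\<forall>\<beta>'\<in>D'. \<beta>' < \<beta> \<longrightarrow> (\<forall>\<alpha>\<le>\<beta>'. f \<beta> \<alpha> = f \<beta>' \<alpha>))"
  proof (rule dependent_wf_choice[OF wf, where P = "\<lambda>f \<beta> r. \<beta> \<in> D' \<longrightarrow> good \<beta> r \<and>
           (\<forall>\<beta>'\<in>D'. \<beta>' < \<beta> \<longrightarrow> (\<forall>\<alpha>\<le>\<beta>'. r \<alpha> = f \<beta>' \<alpha>))"])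
    fix f g :: "'k \<Rightarrow> 'k \<Rightarrow> 'k" and \<beta> r
    assume "\<And>z. (z, \<beta>) \<in> {(x, y). x < y} \<Longrightarrow> f z = g z"
    then show "(\<beta> \<in> D' \<longrightarrow> good \<beta> r \<and> (\<forall>\<beta>'\<in>D'. \<beta>' < \<beta> \<longrightarrow> (\<forall>\<alpha>\<le>\<beta>'. r \<alpha> = f \<beta>' \<alpha>))) =
      (\<beta> \<in> D' \<longrightarrow> good \<beta> r \<and> (\<forall>\<beta>'\<in>D'. \<beta>' < \<beta> \<longrightarrow> (\<forall>\<alpha>\<le>\<beta>'. r \<alpha> = g \<beta>' \<alpha>)))"
      by simp
  next
    fix \<beta> and f :: "'k \<Rightarrow> 'k \<Rightarrow> 'k"
    assume "\<And>y. (y, \<beta>) \<in> {(x, y). x < y} \<Longrightarrow> y \<in> D' \<longrightarrow> good y (f y) \<and>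
           (\<forall>\<beta>'\<in>D'. \<beta>' < y \<longrightarrow> (\<forall>\<alpha>\<le>\<beta>'. f y \<alpha> = f \<beta>' \<alpha>))"
    then have f: "good y (f y)" and coh: "\<And>y' \<alpha>. y' \<in> D' \<Longrightarrow> y' < y \<Longrightarrow> \<alpha> \<le> y' \<Longrightarrow> f y \<alpha> = f y' \<alpha>"
      if "y \<in> D'" "y < \<beta>" for y
      using that by auto
    show "\<exists>r. \<beta> \<in> D' \<longrightarrow> good \<beta> r \<and> (\<forall>\<beta>'\<in>D'. \<beta>' < \<beta> \<longrightarrow> (\<forall>\<alpha>\<le>\<beta>'. r \<alpha> = f \<beta>' \<alpha>))"
    proof (cases "\<beta> \<in> D'")
      case False
      then show ?thesis by blast
    next
      case \<beta>: True
      then have \<beta>A: "\<beta> \<in> A" and d\<beta>: "d \<le> \<beta>" using DA unfolding D'_def by blast+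
      \<comment> \<open>The union of the earlier stages. From \<open>d\<close> on, the least stage that covers \<open>\<alpha>\<close> determines the value at \<open>\<alpha>\<close>,
        and by coherence so does every other stage below \<open>\<beta>\<close> that covers it.\<close>
      define u where "u \<alpha> = (if \<alpha> < d then c0 \<alpha> else f (LEAST y. y \<in> D' \<and> \<alpha> \<le> y) \<alpha>)" for \<alpha>
      have u_eq: "u \<alpha> = f y \<alpha>" if y: "y \<in> D'" "y < \<beta>" and "\<alpha> \<le> y" for \<alpha> y
      proof (cases "\<alpha> < d")
        case True
        then show ?thesis using f[OF y] unfolding u_def good_def by simp
      next
        case False
        let ?l = "LEAST y. y \<in> D' \<and> \<alpha> \<le> y"
        have l: "?l \<in> D' \<and> \<alpha> \<le> ?l" by (rule LeastI[of "\<lambda>y. y \<in> D' \<and> \<alpha> \<le> y" y]) (use that in blast)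
        have "?l \<le> y" by (rule Least_le) (use that in blast)
        then have "f ?l \<alpha> = f y \<alpha>" using coh[OF y, of ?l \<alpha>] l by (cases "?l = y") auto
        then show ?thesis using False unfolding u_def by simp
      qed
      \<comment> \<open>The domain of \<open>u\<close>: the bound \<open>d \<le> s\<close> covers the first stage \<open>\<beta> = d\<close>, where there are no earlier ones.\<close>
      define s where "s = (LEAST t. d \<le> t \<and> (\<forall>y\<in>D'. y < \<beta> \<longrightarrow> y < t))"
      have s: "d \<le> s" "\<And>y. y \<in> D' \<Longrightarrow> y < \<beta> \<Longrightarrow> y < s"
        using LeastI[of "\<lambda>t. d \<le> t \<and> (\<forall>y\<in>D'. y < \<beta> \<longrightarrow> y < t)" \<beta>] d\<beta> unfolding s_def by auto
      have s\<beta>: "s \<le> \<beta>" unfolding s_def by (rule Least_le) (use d\<beta> in blast)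
      have below_s: "\<alpha> < d \<or> (\<exists>y\<in>D'. y < \<beta> \<and> \<alpha> \<le> y)" if "\<alpha> < s" for \<alpha>
        using not_less_Least[of \<alpha> "\<lambda>t. d \<le> t \<and> (\<forall>y\<in>D'. y < \<beta> \<longrightarrow> y < t)"] that
        unfolding s_def by (auto simp: not_less)
      have u_low: "u \<alpha> = c0 \<alpha>" if "\<alpha> < d" for \<alpha> using that unfolding u_def by simp
      have u_high: "if \<alpha> \<in> M then u \<alpha> = \<xi> else u \<alpha> \<in> x'" if \<alpha>: "d \<le> \<alpha>" "\<alpha> < s" for \<alpha>
      proof -
        obtain y where y: "y \<in> D'" "y < \<beta>" "\<alpha> \<le> y" using below_s[OF \<alpha>(2)] \<alpha>(1) by auto
        then show ?thesis using f[OF y(1,2)] u_eq[OF y] \<alpha>(1) unfolding good_def by auto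
      qed
      have u_part: "suitable {..y} u" if "y \<in> D'" "y < \<beta>" for y
        using f[OF that] suitable_cong[of "{..y}" u "f y"] u_eq[OF that]
        unfolding good_def by auto
      have u: "suitable {..<s} u"
      proof (cases "\<exists>y\<in>D'. y < \<beta> \<and> {..<s} \<subseteq> {..y}")
        case True
        then show ?thesis using u_part suitable_subset by blast
      next
        case no_max: False
        \<comment> \<open>Either nothing has been done beyond \<open>c0\<close>, or \<open>s\<close> is an accumulation point of \<open>D\<close>.\<close>
        show ?thesis
        proof (cases "s = d")
          case True
          then show ?thesis using c0(1) suitable_cong[of "{..<s}" u c0] u_low by auto
        next
          case False
          then have "d < s" using s(1) by simp
          then have pos: "zero_ord < s" using zero_ord_le le_less_trans by blast
          have step: "\<exists>y\<in>D'. \<alpha> < y \<and> y < s \<and> y < \<beta>" if \<alpha>: "\<alpha> < s" for \<alpha>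
          proof -
            have "max \<alpha> d < s" using \<alpha> \<open>d < s\<close> by simp
            then obtain y where y: "y \<in> D'" "y < \<beta>" "max \<alpha> d \<le> y"
              using below_s[of "max \<alpha> d"] by (auto simp: not_less)
            have "\<not> {..<s} \<subseteq> {..y}" using no_max y(1,2) by blast
            then obtain z where z: "z < s" "y < z" by (meson atMost_iff lessThan_iff not_le subsetI)
            then obtain y' where y': "y' \<in> D'" "y' < \<beta>" "z \<le> y'"
              using below_s[of z] y(3) by auto
            moreover have "\<alpha> < y'" using y(3) le_less_trans[OF _ less_le_trans[OF z(2) y'(3)], of \<alpha>] by simp
            ultimately show ?thesis using s(2) by blast
          qed
          have lim: "limit_ord s" using pos step unfolding limit_ord_def by blast
          have unb: "\<exists>y\<in>D. \<alpha> < y \<and> y < s" if "\<alpha> < s" for \<alpha>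
            using step[OF that] unfolding D'_def by blast
          have "s \<in> A" using A \<beta>A s\<beta> by blast
          then have "s \<in> D" using closed_inD[OF Dcl _ pos unb] by blast
          then have sacc: "s \<in> acc D" using pos unb by (simp add: mem_acc_iff)
          show ?thesis
          proof (rule suitable_limit[OF lim])
            fix t assume "t < s"
            then obtain y where "y \<in> D'" "t < y" "y < \<beta>" using step by blast
            then show "suitable {..<t} u" by (intro suitable_subset[OF u_part[of y]]) auto
          next
            assume "cf s = \<chi>" "s \<in> G"
            \<comment> \<open>Since \<open>D\<close> and \<open>C s\<close> agree below \<open>s\<close>, they have the same skipping points there,
              and those above \<open>d\<close> have been colored with \<open>\<xi>\<close>.\<close>
            then have "D \<inter> {..<s} = C s \<inter> {..<s}" using guess[of s] sacc C_below by blast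
            then have "skip D \<inter> {..<s} = skip (C s) \<inter> {..<s}" by (rule skipping_local)
            then have "\<forall>\<alpha>\<in>skip (C s). d < \<alpha> \<and> \<alpha> < s \<longrightarrow> \<alpha> \<in> M" unfolding M_def by blast
            then have "\<forall>\<alpha>\<in>skip (C s). d < \<alpha> \<and> \<alpha> < s \<longrightarrow> u \<alpha> = \<xi>"
              using u_high less_imp_le by metis
            then show "\<exists>d<s. \<exists>\<xi>. \<forall>\<alpha>\<in>skip (C s). d < \<alpha> \<and> \<alpha> < s \<longrightarrow> u \<alpha> = \<xi>"
              using \<open>d < s\<close> by blast
          qed
        qed
      qed
      obtain v where v: "suitable {..<\<beta>} v" "\<And>\<alpha>. \<alpha> < s \<Longrightarrow> v \<alpha> = u \<alpha>"
          "\<And>\<alpha>. s \<le> \<alpha> \<Longrightarrow> \<alpha> < \<beta> \<Longrightarrow> v \<alpha> \<in> x'"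
        using extendableE[OF ext[OF \<beta>A] x' s\<beta> u] by blast
      have v_high: "if \<alpha> \<in> M then v \<alpha> = \<xi> else v \<alpha> \<in> x'" if "d \<le> \<alpha>" "\<alpha> < \<beta>" for \<alpha>
      proof (cases "\<alpha> < s")
        case True
        then show ?thesis using u_high v(2) that by simp
      next
        case False
        \<comment> \<open>There is no point of \<open>D\<close> in \<open>[s, \<beta>)\<close>, so the gap needs no use of \<open>\<xi>\<close>.\<close>
        then have "\<alpha> \<notin> M"
          using s(2)[of \<alpha>] that unfolding D'_def M_def skipping_def by auto
        then show ?thesis using v(3) that False by auto
      qed
      obtain a where a: "a < \<chi>" "a \<notin> v ` N \<beta>" "if \<beta> \<in> M then a = \<xi> else a \<in> x'"
      proof (cases "\<beta> \<in> M")
        case True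
        \<comment> \<open>\<open>C \<beta>\<close> lies above all points of \<open>D\<close> below \<open>\<beta>\<close>, so \<open>N \<beta>\<close> lies above \<open>d\<close> and is disjoint from \<open>D\<close>:
          the color \<open>\<xi>\<close> does not occur there.\<close>
        have "v \<alpha> \<noteq> \<xi>" if "\<alpha> \<in> N \<beta>" for \<alpha>
        proof -
          have \<alpha>: "\<alpha> \<in> C \<beta>" "\<alpha> < \<beta>" using that N_subset_C C_below by blast+
          have far: "\<eta> < \<alpha>" if "\<eta> \<in> D" "\<eta> < \<beta>" for \<eta>
            using True that \<alpha>(1) unfolding M_def skipping_def by blast
          have "d < \<alpha>" using far d(1) True unfolding M_def by blast
          moreover have "\<alpha> \<notin> M" using far[of \<alpha>] \<alpha>(2) unfolding M_def skipping_def by blast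
          ultimately show ?thesis using v_high[of \<alpha>] \<alpha>(2) unfolding x'_def by auto
        qed
        then show ?thesis using that[of \<xi>] True \<xi> x by auto
      next
        case False
        have "N \<beta> \<inter> {..<\<beta>} = N \<beta>" using N_subset_C C_below by blast
        then have "small (v ` N \<beta>)" using v(1) unfolding suitable_coloring_def by metis
        then obtain a where "a \<in> x'" "a \<notin> v ` N \<beta>" "a < \<chi>" using full_minus_small[OF x'] by blast
        then show ?thesis using that False by simp
      qed
      let ?r = "v(\<beta> := a)"
      have "suitable {..\<beta>} ?r" using suitable_add_point[OF v(1) a(1,2)] .
      moreover have "\<forall>\<alpha><d. ?r \<alpha> = c0 \<alpha>" using v(2) u_low s(1) d\<beta> by auto
      moreover have "if \<alpha> \<in> M then ?r \<alpha> = \<xi> else ?r \<alpha> \<in> x'" if "d \<le> \<alpha>" "\<alpha> \<le> \<beta>" for \<alpha>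
        using v_high[of \<alpha>] a(3) that by (cases "\<alpha> = \<beta>") auto
      ultimately have "good \<beta> ?r" unfolding good_def by blast
      moreover have "?r \<alpha> = f y \<alpha>" if "y \<in> D'" "y < \<beta>" "\<alpha> \<le> y" for y \<alpha>
        using u_eq[OF that] v(2)[of \<alpha>] s(2)[OF that(1,2)] that by auto
      ultimately show ?thesis by blast
    qed
  qed
  then obtain f where f: "\<And>\<beta>. \<beta> \<in> D' \<Longrightarrow> good \<beta> (f \<beta>)"
    and coh: "\<And>\<beta> \<beta>' \<alpha>. \<beta> \<in> D' \<Longrightarrow> \<beta>' \<in> D' \<Longrightarrow> \<beta>' < \<beta> \<Longrightarrow> \<alpha> \<le> \<beta>' \<Longrightarrow> f \<beta> \<alpha> = f \<beta>' \<alpha>"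
    by blast
  define c' where "c' \<alpha> = f (LEAST y. y \<in> D' \<and> \<alpha> \<le> y) \<alpha>" for \<alpha>
  have c'_eq: "c' \<alpha> = f y \<alpha>" if y: "y \<in> D'" and "\<alpha> \<le> y" for \<alpha> y
  proof -
    let ?l = "LEAST y. y \<in> D' \<and> \<alpha> \<le> y"
    have l: "?l \<in> D' \<and> \<alpha> \<le> ?l" by (rule LeastI[of "\<lambda>y. y \<in> D' \<and> \<alpha> \<le> y" y]) (use that in blast)
    have "?l \<le> y" by (rule Least_le) (use that in blast)
    then show ?thesis using coh[OF y, of ?l \<alpha>] l unfolding c'_def by (cases "?l = y") auto
  qed
  have cofinal: "\<exists>y\<in>D'. \<alpha> \<le> y" if "\<alpha> \<in> A" for \<alpha>
  proof -
    have "max \<alpha> d \<in> A" using that dA by (simp add: max_def)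
    then obtain \<eta> where "\<eta> \<in> D" "max \<alpha> d \<le> \<eta>" using Dunb by blast
    then show ?thesis unfolding D'_def by auto
  qed
  have c'_low: "c' \<alpha> = c0 \<alpha>" if "\<alpha> < d" for \<alpha>
    using c'_eq[of d \<alpha>] f[of d] d(1) that unfolding D'_def good_def by auto
  have c'_high: "if \<alpha> \<in> M then c' \<alpha> = \<xi> else c' \<alpha> \<in> x'" if \<alpha>: "d \<le> \<alpha>" "\<alpha> \<in> A" for \<alpha>
  proof -
    obtain y where y: "y \<in> D'" "\<alpha> \<le> y" using cofinal[OF \<alpha>(2)] by blast
    then show ?thesis using f[OF y(1)] c'_eq[OF y] \<alpha>(1) unfolding good_def by auto
  qed
  show ?thesis
  proof (rule that[of c' d \<xi>])
    fix \<eta> assume "\<eta> \<in> A"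
    then obtain y where y: "y \<in> D'" "\<eta> \<le> y" using cofinal by blast
    have "suitable {..y} c'"
      using f[OF y(1)] suitable_cong[of "{..y}" c' "f y"] c'_eq[OF y(1)] unfolding good_def by auto
    then show "suitable {..\<eta>} c'" by (rule suitable_subset) (use y in auto)
  next
    show "c' \<alpha> = c \<alpha>" if "\<alpha> < \<epsilon>" for \<alpha>
      using c'_low c0(2) that d(2) by simp
  next
    show "c' \<alpha> \<in> x" if "\<epsilon> \<le> \<alpha>" "\<alpha> \<in> A" for \<alpha>
    proof (cases "\<alpha> < d")
      case True
      then show ?thesis using c'_low c0(3) that by simp
    next
      case False
      then have "d \<le> \<alpha>" by simp
      then show ?thesis
        using c'_high[of \<alpha>] that(2) \<xi> unfolding x'_def by (cases "\<alpha> \<in> M") auto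
    qed
  next
    show "c' \<alpha> = \<xi>" if "\<alpha> \<in> skip D" "d < \<alpha>" for \<alpha>
    proof -
      have "\<alpha> \<in> A" using that(1) DA unfolding skipping_def by blast
      then show ?thesis using c'_high[of \<alpha>] that unfolding M_def by auto
    qed
  qed (rule dA)
qed

text \<open>
  At a successor, the new point avoids the small set of colors on its neighbourhood. At a limit \<open>\<delta>\<close>, the
  construction runs along \<open>C \<delta>\<close>.
\<close>

lemma extendable_all: "extendable \<delta>"
proof (induction \<delta> rule: less_induct)
  case (less \<delta>)
  show ?case
    unfolding extendable_def
  proof (intro allI impI, elim conjE)
    fix x \<epsilon> c
    assume x: "x \<subseteq> {..<\<chi>}" "|x| =o |{..<\<chi>}|" and \<epsilon>: "\<epsilon> \<le> \<delta>" and c: "suitable {..<\<epsilon>} c"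
    let ?goal = "\<lambda>c'. suitable {..<\<delta>} c' \<and> (\<forall>\<alpha><\<epsilon>. c' \<alpha> = c \<alpha>) \<and> c' ` ({..<\<delta>} - {..<\<epsilon>}) \<subseteq> x"
    consider "\<epsilon> = \<delta>" | "\<epsilon> < \<delta>" "limit_ord \<delta>" | "\<epsilon> < \<delta>" "\<not> limit_ord \<delta>"
      using \<epsilon> by fastforce
    then show "\<exists>c'. ?goal c'"
    proof cases
      case 1
      then show ?thesis using c by (intro exI[of _ c]) auto
    next
      case 2
      have club: "club_in (C \<delta>) {..<\<delta>}" using C_seq 2(2) unfolding C_sequence_def by blast
      have guess: "C \<delta> \<inter> {..<\<eta>} = C \<eta>" if "\<eta> \<in> acc (C \<delta>) \<inter> G" "cf \<eta> = \<chi>" for \<eta>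
      proof -
        have "\<delta> \<in> G" using that(1) avoids unfolding acc_def by blast
        then show ?thesis using coherent that by blast
      qed
      obtain c' d \<xi> where c': "\<And>\<eta>. \<eta> \<in> {..<\<delta>} \<Longrightarrow> suitable {..\<eta>} c'" "\<And>\<alpha>. \<alpha> < \<epsilon> \<Longrightarrow> c' \<alpha> = c \<alpha>"
          "\<And>\<alpha>. \<epsilon> \<le> \<alpha> \<Longrightarrow> \<alpha> \<in> {..<\<delta>} \<Longrightarrow> c' \<alpha> \<in> x"
          "d \<in> {..<\<delta>}" "\<And>\<alpha>. \<alpha> \<in> skip (C \<delta>) \<Longrightarrow> d < \<alpha> \<Longrightarrow> c' \<alpha> = \<xi>"
        by (rule extension_along_club[OF x _ club guess _ _ c]) (use less 2(1) in auto)
      have "suitable {..<\<delta>} c'"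
      proof (rule suitable_limit[OF 2(2)])
        fix t assume "t < \<delta>"
        then show "suitable {..<t} c'" by (intro suitable_subset[OF c'(1)[of t]]) auto
      qed (use c'(4,5) in auto)
      then show ?thesis using c'(2,3) by (intro exI[of _ c']) auto
    next
      case 3
      have "zero_ord < \<delta>" using 3(1) zero_ord_le le_less_trans by blast
      then obtain \<beta> where \<beta>: "\<beta> < \<delta>" "\<And>\<gamma>. \<beta> < \<gamma> \<Longrightarrow> \<not> \<gamma> < \<delta>"
        using 3(2) unfolding limit_ord_def by blast
      have pred: "{..<\<delta>} = {..\<beta>}" using \<beta> by (auto simp: not_less[symmetric] intro: le_less_trans)
      then have "\<epsilon> \<le> \<beta>" using 3(1) by auto
      then obtain v where v: "suitable {..<\<beta>} v" "\<And>\<alpha>. \<alpha> < \<epsilon> \<Longrightarrow> v \<alpha> = c \<alpha>"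
          "\<And>\<alpha>. \<epsilon> \<le> \<alpha> \<Longrightarrow> \<alpha> < \<beta> \<Longrightarrow> v \<alpha> \<in> x"
        using extendableE[OF less[OF \<beta>(1)] x _ c] by blast
      have "N \<beta> \<inter> {..<\<beta>} = N \<beta>" using N_subset_C C_below by blast
      then have "small (v ` N \<beta>)" using v(1) unfolding suitable_coloring_def by metis
      then obtain a where a: "a \<in> x" "a \<notin> v ` N \<beta>" "a < \<chi>" using full_minus_small[OF x] by blast
      have "suitable {..<\<delta>} (v(\<beta> := a))"
        unfolding pred by (rule suitable_add_point[OF v(1) a(3,2)])
      then show ?thesis
        using v(2,3) a(1) \<open>\<epsilon> \<le> \<beta>\<close> unfolding pred
        by (intro exI[of _ "v(\<beta> := a)"]) (auto simp: not_less le_less)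
    qed
  qed
qed

text \<open>
  The construction runs along \<open>D\<close> through all of \<open>\<kappa>\<close>, starting from the empty coloring; the result is
  proper, as any two vertices lie in a common initial segment.
\<close>

lemma Chr_le:
  assumes D: "club_in D UNIV"
    and guess: "\<And>\<eta>. \<eta> \<in> acc D \<inter> G \<Longrightarrow> cf \<eta> = \<chi> \<Longrightarrow> D \<inter> {..<\<eta>} = C \<eta>"
  shows "Chr (C_graph C G) \<le>o |{..<\<chi>}|"
proof -
  have empty: "{..<zero_ord :: 'k} = {}" by (auto simp: set_eq_iff not_less)
  have x: "{..<\<chi>} \<subseteq> {..<\<chi>}" "|{..<\<chi>}| =o |{..<\<chi>}|" by (simp_all add: card_of_refl)
  have start: "suitable {..<zero_ord} id"
    unfolding empty suitable_coloring_def
    using small_finite[of "{}"] by simp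
  obtain c d \<xi> where c: "\<And>\<eta>. \<eta> \<in> UNIV \<Longrightarrow> suitable {..\<eta>} c"
    by (rule extension_along_club[OF x _ D guess _ _ start]) (use extendable_all in auto)
  have "colorable (C_graph C G) |{..<\<chi>}|"
    unfolding colorable_def C_graph_def prod.case Field_card_of
  proof (intro exI[of _ c] conjI ballI impI)
    show "c ` G \<subseteq> {..<\<chi>}"
      using c unfolding suitable_coloring_def by blast
  next
    fix \<alpha> \<beta> assume "{\<alpha>, \<beta>} \<in> C_edges C G"
    then show "c \<alpha> \<noteq> c \<beta>"
      using c[of "max \<alpha> \<beta>"] unfolding suitable_coloring_def by auto
  qed
  then have col: "Card_order |{..<\<chi>}| \<and> colorable (C_graph C G) |{..<\<chi>}|"
    using card_of_Card_order by blast
  have "is_Chr (C_graph C G) (Chr (C_graph C G))"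
    unfolding C_graph_def by (rule is_Chr_Chr) (auto simp: C_edges_def)
  then have "\<forall>\<mu> :: 'k rel. Card_order \<mu> \<and> colorable (C_graph C G) \<mu> \<longrightarrow> Chr (C_graph C G) \<le>o \<mu>"
    unfolding is_Chr_def by (elim conjE)
  from this[rule_format, OF col] show ?thesis .
qed

end

theorem lemma2p11:
  fixes \<chi> :: "'k::wellorder"
    and C :: "'k \<Rightarrow> 'k set"
    and G :: "'k set"
  assumes "infinite_regular_cardinal (UNIV :: 'k set)"
    and "infinite_regular_cardinal {..<\<chi>}"
    and "C_sequence C"
    and "unbounded_in G UNIV"
    and aleph: "\<And>\<alpha>. \<alpha> \<notin> G \<Longrightarrow> C \<alpha> \<inter> G = {}"
    and beth: "\<And>\<alpha> \<alpha>'. \<alpha> \<in> G \<Longrightarrow> \<alpha>' \<in> acc (C \<alpha>) \<Longrightarrow> cf \<alpha>' = \<chi> \<Longrightarrow>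
                 \<alpha>' \<in> G \<and> C \<alpha>' = C \<alpha> \<inter> {..<\<alpha>'}"
  shows "(\<forall>\<delta>. \<forall>x. x \<subseteq> {..<\<chi>} \<and> |x| =o |{..<\<chi>}| \<longrightarrow>
            (\<forall>\<epsilon>\<le>\<delta>. \<forall>c. suitable_coloring C G \<chi> {..<\<epsilon>} c \<longrightarrow>
               (\<exists>c'. suitable_coloring C G \<chi> {..<\<delta>} c' \<and>
                     (\<forall>\<alpha><\<epsilon>. c' \<alpha> = c \<alpha>) \<and>
                     c' ` ({..<\<delta>} - {..<\<epsilon>}) \<subseteq> x))) \<and>
         ((\<exists>D. club_in D UNIV \<and>
               (\<forall>\<eta> \<in> acc D \<inter> G. cf \<eta> = \<chi> \<longrightarrow> D \<inter> {..<\<eta>} = C \<eta>)) \<longrightarrow>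
            Chr (C_graph C G) \<le>o |{..<\<chi>}| )"
proof -
  interpret coherent_C_sequence \<chi> C G
    by (intro coherent_C_sequence.intro assms(2,3) aleph beth)
  show ?thesis
  proof (rule conjI, rule allI, rule extendable_all[unfolded extendable_def], intro impI, elim exE conjE)
    fix D :: "'k set"
    assume "club_in D UNIV" "\<forall>\<eta> \<in> acc D \<inter> G. cf \<eta> = \<chi> \<longrightarrow> D \<inter> {..<\<eta>} = C \<eta>"
    then show "Chr (C_graph C G) \<le>o |{..<\<chi>}|" by (intro Chr_le) blast+
  qed
qed

end
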